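(* The set of all points $(\tau,\kappa)\in\mathbb R^2$ such that $\tau$ is the skewness and $\kappa$ is the kurtosis of some symmetric unimodal probability distribution on $\mathbb R$ (with finite fourth moment and positive variance) equals $\{(0,y)\in\mathbb R^2 : y\ge 9/5\}$.
   Context: For a real random variable $X$ with finite fourth moment, mean $\mu$ and variance $\sigma^2>0$, the skewness is $\tau=E((X-\mu)^3)/\sigma^3$ and the kurtosis is $\kappa=E((X-\mu)^4)/\sigma^4$ (not the excess kurtosis). A distribution is unimodal if its distribution function $F$ is convex--concave, i.e. there is $m\in\mathbb R$ such that $F$ is convex on $(-\infty,m)$ and concave on $(m,\infty)$; an atom at $m$ is allowed. A distribution is symmetric if there is $c\in\mathbb R$ such that $X-c$ and $c-X$ have the same distribution when $X$ has the given distribution. *)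

theory Defs
  imports "HOL-Probability.Probability"
begin

text \<open>
  A probability distribution on the reals is a measure \<open>M\<close> with \<open>real_distribution M\<close>;
  the moments are those of the identity random variable on \<open>M\<close>.
  Finiteness of the fourth moment and positivity of the variance are not part of the
  definitions of skewness and kurtosis and are imposed separately.
\<close>

definition dist_mean :: "real measure \<Rightarrow> real" where
  "dist_mean M = (\<integral>x. x \<partial>M)"

definition dist_variance :: "real measure \<Rightarrow> real" where
  "dist_variance M = (\<integral>x. (x - dist_mean M) ^ 2 \<partial>M)"

definition dist_sd :: "real measure \<Rightarrow> real" where
  "dist_sd M = sqrt (dist_variance M)"

definition skewness :: "real measure \<Rightarrow> real" where
  "skewness M = (\<integral>x. (x - dist_mean M) ^ 3 \<partial>M) / dist_sd M ^ 3"

definition kurtosis :: "real measure \<Rightarrow> real" where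
  "kurtosis M = (\<integral>x. (x - dist_mean M) ^ 4 \<partial>M) / dist_sd M ^ 4"

text \<open>The two half-lines are open, so the distribution function may jump at the mode.\<close>

definition unimodal :: "real measure \<Rightarrow> bool" where
  "unimodal M \<longleftrightarrow> (\<exists>m. convex_on {..<m} (cdf M) \<and> concave_on {m<..} (cdf M))"

definition symmetric_dist :: "real measure \<Rightarrow> bool" where
  "symmetric_dist M \<longleftrightarrow> (\<exists>c. distr M borel (\<lambda>x. x - c) = distr M borel (\<lambda>x. c - x))"

end

theory Submission
  imports Defs
begin

text \<open>
  Skewness vanishes because odd central moments of a symmetric distribution do, so the content
  lies in the range of the kurtosis.
  
  Lower bound. Let \<open>c\<close> be the center of symmetry of \<open>M\<close>, and let \<open>G\<close> be the distribution function of
  \<open>\<bar>X - c\<bar>\<close>. By reflecting about \<open>c\<close> one sees that unimodality, with whatever mode \<open>m\<close>, makes \<open>G\<close>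
  concave on the positive half-line (lemma \<open>concave_cdf_abs_deviation\<close>), so \<open>G t / t\<close> decreases.
  The graph of \<open>G\<close> therefore crosses that of the uniform distribution on \<open>[0, z]\<close> once, from above to
  below, and \<open>z\<close> can be chosen to put the crossing at any prescribed point \<open>r\<close>. Coupling both
  distributions through their quantile functions, the uniform variable lies between \<open>r\<close> and
  \<open>\<bar>X - c\<bar>\<close> almost surely. Hence \<open>E q \<bar>X - c\<bar>\<close> is at least the uniform mean of \<open>q\<close>, for every \<open>q\<close>
  that decreases up to \<open>r\<close> and increases from there on. For
  \<open>q y = y\<^sup>4 - 6/5 A y\<^sup>2 + A\<^sup>2/5\<close> this uniform mean is \<open>(z\<^sup>2 - A)\<^sup>2 / 5 \<ge> 0\<close>, whatever \<open>z\<close> is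
  (lemma \<open>test_polynomial_expectation_nonneg\<close>). With \<open>s\<close> the variance and \<open>A = 3 s\<close>, the inequality
  \<open>E q \<bar>X - c\<bar> \<ge> 0\<close> reads \<open>E (X - c)\<^sup>4 \<ge> 9/5 s\<^sup>2\<close>.
  
  Attainment. Mixing the uniform distribution on \<open>[-w, w]\<close>, taken with weight \<open>w\<close>, and an atom at
  \<open>0\<close> of weight \<open>1 - w\<close> gives a symmetric unimodal distribution with variance \<open>w\<^sup>3/3\<close> and fourth
  moment \<open>w\<^sup>5/5\<close>, hence with kurtosis \<open>9 / (5 w)\<close>; this runs through \<open>[9/5, \<infinity>)\<close> as \<open>w\<close> runs through
  \<open>(0, 1]\<close>.
\<close>

section \<open>Comparison with a uniform distribution\<close>

text \<open>
  The point \<open>(s, g s)\<close> lies above the chord from \<open>(e, g e)\<close> to \<open>(t, g t)\<close> for each small \<open>e > 0\<close>, and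
  \<open>g e \<ge> 0\<close>; let \<open>e\<close> tend to \<open>0\<close>. Working with \<open>e\<close> instead of \<open>0\<close> keeps the lemma applicable when
  \<open>g\<close> jumps at the origin.
\<close>

lemma concave_nonneg_imp_ratio_antimono:
  fixes g :: "real \<Rightarrow> real"
  assumes conc: "concave_on {0<..} g" and nonneg: "\<And>x. x > 0 \<Longrightarrow> g x \<ge> 0"
    and st: "0 < s" "s \<le> t"
  shows "s * g t \<le> t * g s"
proof (cases "s = t")
  case False
  have ineq: "(s - e) * g t \<le> (t - e) * g s" if e: "0 < e" "e < s" for e
  proof -
    define u where "u = (s - e) / (t - e)"
    have te: "t - e > 0" using e st by simp
    have u: "0 \<le> u" "u \<le> 1" using e st te by (auto simp: u_def field_simps)
    have "u * (t - e) = s - e" using te by (simp add: u_def)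
    then have s_eq: "(1 - u) *\<^sub>R e + u *\<^sub>R t = s" by (simp add: algebra_simps)
    have "(1 - u) * g e + u * g t \<le> g s"
      using concave_onD[OF conc u, of e t] e st s_eq by simp
    moreover have "0 \<le> (1 - u) * g e" using u nonneg[of e] e by simp
    ultimately have "u * g t \<le> g s" by linarith
    then show ?thesis using te by (simp add: u_def field_simps)
  qed
  show ?thesis
  proof (rule tendsto_le)
    show "((\<lambda>e. (s - e) * g t) \<longlongrightarrow> s * g t) (at_right 0)"
      by (auto intro!: tendsto_eq_intros)
    show "((\<lambda>e. (t - e) * g s) \<longlongrightarrow> t * g s) (at_right 0)"
      by (auto intro!: tendsto_eq_intros)
    show "\<forall>\<^sub>F e in at_right 0. (s - e) * g t \<le> (t - e) * g s"
      using ineq st by (auto simp: eventually_at_right_field)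
  qed simp
qed simp

text \<open>
  The coefficients of the test polynomial are those for which its antiderivative vanishing at \<open>0\<close> is
  \<open>y (y\<^sup>2 - A)\<^sup>2 / 5\<close>: its mean over \<open>[0, z]\<close> is then nonnegative, and zero at \<open>z = sqrt A\<close>. The base space
  is the one on which quantile functions are defined.
\<close>

lemma uniform_test_polynomial:
  fixes A z :: real
  shows "has_bochner_integral (restrict_space lborel {0<..<1})
           (\<lambda>\<omega>. (z * \<omega>) ^ 4 - 6/5 * A * (z * \<omega>)^2 + A^2 / 5) ((z^2 - A)^2 / 5)"
proof -
  let ?f = "\<lambda>\<omega>. (z * \<omega>) ^ 4 - 6/5 * A * (z * \<omega>)^2 + A^2 / 5"
  let ?F = "\<lambda>\<omega>. z^4 * \<omega>^5 / 5 - 2/5 * A * z^2 * \<omega>^3 + A^2 * \<omega> / 5"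
  have "has_bochner_integral lborel (\<lambda>x. ?f x * indicator {0 .. 1} x) (?F 1 - ?F 0)"
  proof (rule has_bochner_integral_FTC_Icc_real)
    fix x :: real
    show "DERIV ?F x :> ?f x"
      by (auto intro!: derivative_eq_intros simp: power_mult_distrib field_simps)
    show "isCont ?f x" by (intro continuous_intros)
  qed simp
  moreover have "?F 1 - ?F 0 = (z^2 - A)^2 / 5"
    by (simp add: power2_eq_square power4_eq_xxxx field_simps)
  ultimately have *: "has_bochner_integral lborel (\<lambda>x. ?f x * indicator {0 .. 1} x) ((z^2 - A)^2 / 5)"
    by (simp only:)
  have "has_bochner_integral lborel (\<lambda>x. indicator {0<..<1} x *\<^sub>R ?f x) ((z^2 - A)^2 / 5)"
  proof (rule has_bochner_integral_cong_AE[THEN iffD1, OF _ _ _ *])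
    show "AE x in lborel. ?f x * indicator {0..1} x = indicator {0<..<1} x *\<^sub>R ?f x"
      using AE_lborel_singleton[of "0::real"] AE_lborel_singleton[of "1::real"]
      by eventually_elim (auto simp: indicator_def)
  qed measurable
  then show ?thesis
    by (subst has_bochner_integral_restrict_space) (auto)
qed

lemma (in real_distribution) integrable_lower_power:
  assumes "integrable M (\<lambda>x. x ^ n)" "k \<le> n"
  shows "integrable M (\<lambda>x. x ^ k)"
proof (rule Bochner_Integration.integrable_bound)
  show "integrable M (\<lambda>x. 1 + \<bar>x ^ n\<bar>)" using assms by simp
  show "AE x in M. norm (x ^ k) \<le> norm (1 + \<bar>x ^ n\<bar>)"
  proof (intro AE_I2)
    fix x :: real
    have "\<bar>x\<bar> ^ k \<le> 1 + \<bar>x\<bar> ^ n"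
    proof (cases "\<bar>x\<bar> \<le> 1")
      case True
      then have "\<bar>x\<bar> ^ k \<le> 1" by (simp add: power_le_one)
      then show ?thesis by (smt (verit) zero_le_power abs_ge_zero)
    next
      case False
      then have "\<bar>x\<bar> ^ k \<le> \<bar>x\<bar> ^ n" using assms by (intro power_increasing) auto
      then show ?thesis by simp
    qed
    then show "norm (x ^ k) \<le> norm (1 + \<bar>x ^ n\<bar>)" by (simp add: power_abs)
  qed
qed simp

text \<open>
  Monotonicity of \<open>cdf N t / t\<close> makes the distribution function lie above a line through the origin
  before a common point \<open>r\<close>, and below it afterwards. Quantiles then compare in the opposite order,
  so that the coupled uniform variable is the one nearer to \<open>r\<close>.
\<close>

lemma test_polynomial_expectation_nonneg:
  fixes A :: real
  assumes N: "real_distribution N" and int4: "integrable N (\<lambda>x. x ^ 4)"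
    and neg: "\<And>x. x < 0 \<Longrightarrow> cdf N x = 0"
    and star: "\<And>s t. 0 < s \<Longrightarrow> s \<le> t \<Longrightarrow> s * cdf N t \<le> t * cdf N s"
    and A: "A > 0"
  shows "(\<integral>x. x ^ 4 - 6/5 * A * x^2 + A^2 / 5 \<partial>N) \<ge> 0"
proof -
  interpret cdf_distribution N using N by (simp add: cdf_distribution_def)
  let ?\<Omega> = "restrict_space lborel {0<..<1::real}"
  define q where "q = (\<lambda>x::real. x ^ 4 - 6/5 * A * x^2 + A^2 / 5)"
  have q_diff: "q y - q v = (y^2 - v^2) * (y^2 + v^2 - 6/5 * A)" for y v
    by (simp add: q_def power2_eq_square power4_eq_xxxx field_simps)
  \<comment> \<open>the minimum of \<open>q\<close> on the positive half-line, where the two distribution functions should cross\<close>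
  define r where "r = sqrt (3/5 * A)"
  have r: "r > 0" "r^2 = 3/5 * A" using A by (auto simp: r_def)
  have q_dec: "q y \<ge> q v" if "0 \<le> y" "y \<le> v" "v \<le> r" for y v
  proof -
    have "y^2 \<le> v^2" "v^2 \<le> r^2" using that by (auto intro!: power_mono)
    then have "(y^2 - v^2) * (y^2 + v^2 - 6/5 * A) \<ge> 0"
      using r by (intro mult_nonpos_nonpos) auto
    then show ?thesis using q_diff[of y v] by simp
  qed
  have q_inc: "q y \<ge> q v" if "r \<le> v" "v \<le> y" for y v
  proof -
    have "v^2 \<le> y^2" "r^2 \<le> v^2" using that r by (auto intro!: power_mono)
    then have "(y^2 - v^2) * (y^2 + v^2 - 6/5 * A) \<ge> 0"
      using r by (intro mult_nonneg_nonneg) auto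
    then show ?thesis using q_diff[of y v] by simp
  qed
  \<comment> \<open>otherwise monotonicity of \<open>C t / t\<close> would make \<open>C\<close> vanish from \<open>r\<close> on, yet it tends to \<open>1\<close>\<close>
  have Cr: "C r > 0"
  proof (rule ccontr)
    assume "\<not> C r > 0"
    then have "C r = 0" using cdf_nonneg[of r] by simp
    have "C t \<le> 1/2" if "t \<ge> r" for t
      using star[of r t] that r \<open>C r = 0\<close> by (simp add: mult_le_0_iff)
    then have "\<forall>\<^sub>F t in at_top. C t \<le> 1/2"
      by (auto simp: eventually_at_top_linorder)
    then have "(1::real) \<le> 1/2"
      by (intro tendsto_upperbound[OF cdf_lim_at_top_prob]) auto
    then show False by simp
  qed
  define z where "z = r / C r"
  have z: "z > 0" "r = z * C r" using r Cr by (auto simp: z_def)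
  have low: "\<omega> \<le> C (z * \<omega>)" if "0 < \<omega>" "z * \<omega> \<le> r" for \<omega>
  proof -
    have "z * \<omega> * C r \<le> r * C (z * \<omega>)" using star[of "z * \<omega>" r] that z by simp
    then have "r * \<omega> \<le> r * C (z * \<omega>)" using z(2) by (simp add: mult.commute mult.left_commute)
    then show ?thesis using r by simp
  qed
  have high: "z * C x \<le> x" if "r \<le> x" for x
  proof -
    have "r * C x \<le> x * C r" using star[of r x] that r by simp
    then show ?thesis using Cr by (simp add: z_def field_simps)
  qed
  \<comment> \<open>\<open>I\<close> is the quantile function of \<open>N\<close>: before the crossing \<open>0 \<le> I \<omega> \<le> z \<omega> \<le> r\<close>, after it
    \<open>r < z \<omega> \<le> I \<omega>\<close>\<close>
  have coupling: "q (z * \<omega>) \<le> q (I \<omega>)" if \<omega>: "\<omega> \<in> {0<..<1}" for \<omega>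
  proof -
    have iff: "\<omega> \<le> C x \<longleftrightarrow> I \<omega> \<le> x" for x using pseudoinverse' \<omega> by blast
    show ?thesis
    proof (cases "z * \<omega> \<le> r")
      case True
      have "I \<omega> \<ge> 0"
      proof (rule dense_le)
        fix x :: real assume "x < 0"
        then show "x \<le> I \<omega>" using iff[of x] neg[of x] \<omega> by auto
      qed
      moreover have "I \<omega> \<le> z * \<omega>" using low[of \<omega>] True \<omega> iff[of "z * \<omega>"] by simp
      ultimately show ?thesis using q_dec True by blast
    next
      case False
      have "z * \<omega> \<le> I \<omega>"
      proof (rule dense_le_bounded)
        show "r < z * \<omega>" using False by simp
        fix x assume x: "r < x" "x < z * \<omega>"
        then have "z * C x < z * \<omega>" using high[of x] by simp
        then show "x \<le> I \<omega>" using z iff[of x] by auto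
      qed
      then show ?thesis using q_inc False by simp
    qed
  qed
  have int2: "integrable N (\<lambda>x. x ^ 2)"
    using integrable_lower_power[OF int4, of 2] by simp
  have intq: "integrable N q" unfolding q_def using int4 int2 by auto
  have I_meas: "I \<in> measurable ?\<Omega> borel" using measurable_CI by (simp add: measurable_def space_restrict_space sets_restrict_space)
  have q_meas: "q \<in> borel_measurable borel" unfolding q_def by measurable
  have "integrable (distr ?\<Omega> borel I) q" using intq by (simp add: distr_I_eq_M)
  then have intqI: "integrable ?\<Omega> (\<lambda>\<omega>. q (I \<omega>))"
    by (rule integrable_distr[OF I_meas])
  note U = uniform_test_polynomial[of z A, folded q_def]
  have "0 \<le> (z^2 - A)^2 / 5" by simp
  also have "\<dots> = (\<integral>\<omega>. q (z * \<omega>) \<partial>?\<Omega>)"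
    using U by (simp add: has_bochner_integral_iff q_def)
  also have "\<dots> \<le> (\<integral>\<omega>. q (I \<omega>) \<partial>?\<Omega>)"
    using U intqI coupling
    by (intro integral_mono) (auto simp: has_bochner_integral_iff q_def space_restrict_space)
  also have "\<dots> = (\<integral>x. q x \<partial>distr ?\<Omega> borel I)"
    using I_meas q_meas by (simp add: integral_distr)
  also have "\<dots> = (\<integral>x. q x \<partial>N)" by (simp add: distr_I_eq_M)
  finally show ?thesis by (simp add: q_def)
qed

section \<open>Symmetric unimodal distributions\<close>

context real_distribution
begin

lemma integral_reflect:
  fixes f :: "real \<Rightarrow> real"
  assumes sym: "distr M borel (\<lambda>x. x - c) = distr M borel (\<lambda>x. c - x)"
    and [measurable]: "f \<in> borel_measurable borel"
  shows "(\<integral>x. f (x - c) \<partial>M) = (\<integral>x. f (c - x) \<partial>M)"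
proof -
  have "(\<integral>x. f (x - c) \<partial>M) = (\<integral>x. f x \<partial>distr M borel (\<lambda>x. x - c))"
    by (subst integral_distr) auto
  also have "\<dots> = (\<integral>x. f (c - x) \<partial>M)"
    unfolding sym by (subst integral_distr) auto
  finally show ?thesis .
qed

lemma odd_central_moment_eq_0:
  assumes sym: "distr M borel (\<lambda>x. x - c) = distr M borel (\<lambda>x. c - x)" and "odd n"
  shows "(\<integral>x. (x - c) ^ n \<partial>M) = 0"
proof -
  have "(c - x) ^ n = - ((x - c) ^ n)" for x
    using power_minus_odd[OF \<open>odd n\<close>, of "x - c"] by simp
  then show ?thesis using integral_reflect[OF sym, of "\<lambda>x. x ^ n"] by simp
qed

lemma symmetric_imp_mean_eq_center:
  assumes sym: "distr M borel (\<lambda>x. x - c) = distr M borel (\<lambda>x. c - x)"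
    and "integrable M (\<lambda>x. x)"
  shows "dist_mean M = c"
  using odd_central_moment_eq_0[OF sym, of 1] assms(2) prob_space by (simp add: dist_mean_def)

text \<open>
  Each of the two expressions serves one position of the mode: the first involves only the part of
  the distribution function to the right of \<open>c\<close>, the second only the part to the left.
\<close>

lemma cdf_abs_deviation:
  assumes sym: "distr M borel (\<lambda>x. x - c) = distr M borel (\<lambda>x. c - x)" and t: "t > 0"
  shows "cdf (distr M borel (\<lambda>x. \<bar>x - c\<bar>)) t = 2 * cdf M (c + t) - 1"
    and "cdf (distr M borel (\<lambda>x. \<bar>x - c\<bar>)) t = 1 - 2 * measure M {..<c - t}"
proof -
  have "measure M {..<c - t} = measure (distr M borel (\<lambda>x. x - c)) {..<- t}"
    by (subst measure_distr) (auto intro!: arg_cong[where f = "measure M"])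
  also have "\<dots> = measure M {c + t<..}"
    unfolding sym by (subst measure_distr) (auto intro!: arg_cong[where f = "measure M"])
  also have "\<dots> = 1 - cdf M (c + t)"
    using prob_compl[of "{..c + t}"] by (simp add: cdf_def2 Compl_atMost flip: Compl_eq_Diff_UNIV)
  finally have left: "measure M {..<c - t} = 1 - cdf M (c + t)" .
  have "cdf (distr M borel (\<lambda>x. \<bar>x - c\<bar>)) t = measure M {c - t..c + t}"
    unfolding cdf_def2 by (subst measure_distr) (auto intro!: arg_cong[where f = "measure M"])
  also have "{c - t..c + t} = {..c + t} - {..<c - t}" by auto
  also have "measure M \<dots> = cdf M (c + t) - measure M {..<c - t}"
    using t by (subst finite_measure_Diff) (auto simp: cdf_def2)
  finally have *: "cdf (distr M borel (\<lambda>x. \<bar>x - c\<bar>)) t = cdf M (c + t) - measure M {..<c - t}" .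
  show "cdf (distr M borel (\<lambda>x. \<bar>x - c\<bar>)) t = 2 * cdf M (c + t) - 1"
    and "cdf (distr M borel (\<lambda>x. \<bar>x - c\<bar>)) t = 1 - 2 * measure M {..<c - t}"
    using * left by simp_all
qed

text \<open>
  The mode \<open>m\<close> may differ from \<open>c\<close>. If \<open>m \<le> c\<close>, the distribution function is concave to the right of
  \<open>c\<close>; otherwise it is convex to the left of \<open>c\<close>. By symmetry one side is enough.
\<close>

lemma concave_cdf_abs_deviation:
  assumes sym: "distr M borel (\<lambda>x. x - c) = distr M borel (\<lambda>x. c - x)"
    and "unimodal M"
  shows "concave_on {0<..} (cdf (distr M borel (\<lambda>x. \<bar>x - c\<bar>)))" (is "concave_on _ ?G")
proof -
  obtain m where conv: "convex_on {..<m} (cdf M)" and conc: "concave_on {m<..} (cdf M)"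
    using \<open>unimodal M\<close> by (auto simp: unimodal_def)
  show ?thesis
  proof (cases "m \<le> c")
    case True
    show ?thesis unfolding concave_on_iff
    proof (intro conjI ballI allI impI)
      fix x y u v :: real
      assume xy: "x \<in> {0<..}" "y \<in> {0<..}" and uv: "0 \<le> u" "0 \<le> v" "u + v = 1"
      have pos: "u * x + v * y > 0"
        using convexD[OF convex_real_interval(3)[of 0] xy uv] by simp
      have "u * (c + x) + v * (c + y) = (u + v) * c + (u * x + v * y)" by (simp add: algebra_simps)
      then have eq: "u * (c + x) + v * (c + y) = c + (u * x + v * y)" using uv by simp
      have "u * cdf M (c + x) + v * cdf M (c + y) \<le> cdf M (u *\<^sub>R (c + x) + v *\<^sub>R (c + y))"
        using conc uv True xy unfolding concave_on_iff by auto
      then have le: "u * cdf M (c + x) + v * cdf M (c + y) \<le> cdf M (c + (u * x + v * y))"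
        using eq by simp
      have "u * (2 * cdf M (c + x) - 1) + v * (2 * cdf M (c + y) - 1) =
          2 * (u * cdf M (c + x) + v * cdf M (c + y)) - (u + v)"
        by (simp add: algebra_simps)
      also have "\<dots> \<le> 2 * cdf M (c + (u * x + v * y)) - 1"
        unfolding uv(3) by (intro diff_mono mult_left_mono le) simp_all
      finally have "u * (2 * cdf M (c + x) - 1) + v * (2 * cdf M (c + y) - 1) \<le>
                 2 * cdf M (c + (u * x + v * y)) - 1" .
      then show "u * ?G x + v * ?G y \<le> ?G (u *\<^sub>R x + v *\<^sub>R y)"
        using xy pos cdf_abs_deviation(1)[OF sym] by simp
    qed simp
  next
    case False
    \<comment> \<open>a convex function is continuous on an open interval, so there are no atoms left of \<open>m\<close>\<close>
    have "continuous_on {..<m} (cdf M)"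
      using convex_on_continuous[OF _ conv] by simp
    then have cont: "isCont (cdf M) a" if "a < m" for a
      using that by (simp add: continuous_on_eq_continuous_at)
    have G: "?G t = 1 - 2 * cdf M (c - t)" if "t > 0" for t
    proof -
      have "measure M {c - t} = 0"
        using cont[of "c - t"] False that by (simp add: isCont_cdf)
      moreover have "{..c - t} = {..<c - t} \<union> {c - t}" by auto
      moreover have "measure M ({..<c - t} \<union> {c - t}) = measure M {..<c - t} + measure M {c - t}"
        by (rule finite_measure_Union) auto
      ultimately show ?thesis
        using cdf_abs_deviation(2)[OF sym that] by (simp add: cdf_def2)
    qed
    show ?thesis unfolding concave_on_iff
    proof (intro conjI ballI allI impI)
      fix x y u v :: real
      assume xy: "x \<in> {0<..}" "y \<in> {0<..}" and uv: "0 \<le> u" "0 \<le> v" "u + v = 1"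
      have pos: "u * x + v * y > 0"
        using convexD[OF convex_real_interval(3)[of 0] xy uv] by simp
      have "u * (c - x) + v * (c - y) = (u + v) * c - (u * x + v * y)" by (simp add: algebra_simps)
      then have eq: "u * (c - x) + v * (c - y) = c - (u * x + v * y)" using uv by simp
      have "cdf M (u *\<^sub>R (c - x) + v *\<^sub>R (c - y)) \<le> u * cdf M (c - x) + v * cdf M (c - y)"
        using conv uv False xy unfolding convex_on_def by auto
      then have le: "cdf M (c - (u * x + v * y)) \<le> u * cdf M (c - x) + v * cdf M (c - y)"
        using eq by simp
      have "u * (1 - 2 * cdf M (c - x)) + v * (1 - 2 * cdf M (c - y)) =
          (u + v) - 2 * (u * cdf M (c - x) + v * cdf M (c - y))"
        by (simp add: algebra_simps)
      also have "\<dots> \<le> 1 - 2 * cdf M (c - (u * x + v * y))"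
        unfolding uv(3) by (intro diff_mono mult_left_mono le) simp_all
      finally have "u * (1 - 2 * cdf M (c - x)) + v * (1 - 2 * cdf M (c - y)) \<le>
                 1 - 2 * cdf M (c - (u * x + v * y))" .
      then show "u * ?G x + v * ?G y \<le> ?G (u *\<^sub>R x + v *\<^sub>R y)"
        using xy pos G by simp
    qed simp
  qed
qed

text \<open>
  The choice \<open>A = 3 s\<close>, with \<open>s\<close> the variance, maximises the resulting lower bound
  \<open>6/5 A s - A\<^sup>2/5\<close> for the fourth central moment, and makes it \<open>9/5 s\<^sup>2\<close>.
\<close>

lemma symmetric_unimodal_kurtosis_ge:
  assumes sym: "distr M borel (\<lambda>x. x - c) = distr M borel (\<lambda>x. c - x)"
    and "unimodal M" and int4: "integrable M (\<lambda>x. x ^ 4)" and var: "dist_variance M > 0"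
  shows "kurtosis M \<ge> 9 / 5"
proof -
  let ?N = "distr M borel (\<lambda>x. \<bar>x - c\<bar>)"
  define s where "s = dist_variance M"
  define k where "k = (\<integral>x. (x - c) ^ 4 \<partial>M)"
  note int = integrable_lower_power[OF int4]
  have mean: "dist_mean M = c"
    using symmetric_imp_mean_eq_center[OF sym] int[of 1] by simp
  have s: "s = (\<integral>x. (x - c) ^ 2 \<partial>M)" by (simp add: s_def dist_variance_def mean)
  have int_c4: "integrable M (\<lambda>x. (x - c) ^ 4)"
  proof -
    have "(x - c) ^ 4 = x ^ 4 - 4 * c * x ^ 3 + 6 * c^2 * x ^ 2 - 4 * c ^ 3 * x ^ 1 + c ^ 4" for x
      by (simp add: power2_eq_square power3_eq_cube power4_eq_xxxx algebra_simps)
    then show ?thesis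
      using int4 int[of 3] int[of 2] int[of 1] by simp
  qed
  have int_c2: "integrable M (\<lambda>x. (x - c) ^ 2)"
  proof -
    have "(x - c) ^ 2 = x ^ 2 - 2 * c * x ^ 1 + c ^ 2" for x
      by (simp add: power2_eq_square algebra_simps)
    then show ?thesis using int[of 2] int[of 1] by simp
  qed
  have N: "real_distribution ?N" by simp
  interpret N: real_distribution ?N by (rule N)
  have "(\<integral>x. x ^ 4 - 6/5 * (3 * s) * x^2 + (3 * s)^2 / 5 \<partial>?N) \<ge> 0"
  proof (rule test_polynomial_expectation_nonneg[OF N])
    show "integrable ?N (\<lambda>x. x ^ 4)"
      using int_c4 by (subst integrable_distr_eq) auto
    show "cdf ?N x = 0" if "x < 0" for x
    proof -
      have "{y. \<bar>y - c\<bar> \<le> x} = {}" using that by auto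
      then show ?thesis unfolding cdf_def2 by (subst measure_distr) (auto simp: vimage_def)
    qed
    show "a * cdf ?N b \<le> b * cdf ?N a" if "0 < a" "a \<le> b" for a b
      using that N.cdf_nonneg
      by (intro concave_nonneg_imp_ratio_antimono concave_cdf_abs_deviation[OF sym \<open>unimodal M\<close>]) auto
    show "3 * s > 0" using var by (simp add: s_def)
  qed
  also have "(\<integral>x. x ^ 4 - 6/5 * (3 * s) * x^2 + (3 * s)^2 / 5 \<partial>?N) =
      (\<integral>x. (x - c) ^ 4 - 6/5 * (3 * s) * (x - c)^2 + (3 * s)^2 / 5 \<partial>M)"
    by (subst integral_distr) auto
  also have "\<dots> = k - 6/5 * (3 * s) * s + (3 * s)^2 / 5"
    using int_c4 int_c2 prob_space by (simp add: k_def s)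
  finally have "9 / 5 * s^2 \<le> k" by (simp add: power2_eq_square)
  moreover have "kurtosis M = k / s^2"
    using var by (simp add: kurtosis_def mean k_def dist_sd_def s_def power4_eq_xxxx power2_eq_square)
  moreover have "s > 0" using var by (simp add: s_def)
  ultimately show ?thesis by (simp add: pos_le_divide_eq)
qed

end

section \<open>Uniform distributions with an atom at the center\<close>

definition uniform_sym :: "real measure" where
  "uniform_sym = density lborel (\<lambda>x. ennreal (indicator {-1..1} x / 2))"

text \<open>
  Collapsing the points outside \<open>[-w, w]\<close> to \<open>0\<close> turns the uniform distribution on \<open>[-1, 1]\<close> into the
  mixture of the uniform distribution on \<open>[-w, w]\<close> and an atom at \<open>0\<close>. This map is odd, so symmetry
  is inherited from the uniform distribution, and positive powers are integrated over \<open>[-w, w]\<close> only.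
\<close>

definition collapse :: "real \<Rightarrow> real \<Rightarrow> real" where
  "collapse w x = (if \<bar>x\<bar> \<le> w then x else 0)"

definition atom_uniform :: "real \<Rightarrow> real measure" where
  "atom_uniform w = distr uniform_sym borel (collapse w)"

lemma collapse_measurable [measurable]: "collapse w \<in> borel_measurable borel"
  unfolding collapse_def by measurable

lemma sets_uniform_sym [simp, measurable_cong]: "sets uniform_sym = sets borel"
  and space_uniform_sym [simp]: "space uniform_sym = UNIV"
  by (simp_all add: uniform_sym_def)

lemma emeasure_uniform_sym:
  assumes [measurable]: "B \<in> sets borel"
  shows "emeasure uniform_sym B = emeasure lborel ({-1..1} \<inter> B) / 2"
proof -
  have "emeasure uniform_sym B = (\<integral>\<^sup>+x. (1/2) * indicator ({-1..1} \<inter> B) x \<partial>lborel)"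
    unfolding uniform_sym_def
    by (subst emeasure_density)
      (auto intro!: nn_integral_cong simp: indicator_def divide_ennreal_def ennreal_divide_numeral simp flip: divide_ennreal)
  also have "\<dots> = (1/2) * emeasure lborel ({-1..1} \<inter> B)"
    by (rule nn_integral_cmult_indicator) simp
  finally show ?thesis by (simp add: divide_ennreal_def mult.commute)
qed

lemma measure_uniform_sym:
  assumes "B \<in> sets borel"
  shows "measure uniform_sym B = measure lborel ({-1..1} \<inter> B) / 2"
proof -
  have "emeasure lborel ({-1..1} \<inter> B) \<le> emeasure lborel {-1..1::real}"
    by (rule emeasure_mono) auto
  also have "\<dots> < \<infinity>" by simp
  finally have "emeasure lborel ({-1..1} \<inter> B) = ennreal (measure lborel ({-1..1} \<inter> B))"
    by (intro emeasure_eq_ennreal_measure) simp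
  then have "emeasure uniform_sym B = ennreal (measure lborel ({-1..1} \<inter> B) / 2)"
    using emeasure_uniform_sym[OF assms] by (simp add: ennreal_divide_numeral)
  then show ?thesis by (simp add: measure_def)
qed

lemma prob_space_uniform_sym: "prob_space uniform_sym"
  by (rule prob_spaceI) (simp add: emeasure_uniform_sym ennreal_divide_self)

lemma uniform_sym_reflect: "distr uniform_sym borel uminus = uniform_sym"
proof (rule measure_eqI)
  fix B assume "B \<in> sets (distr uniform_sym borel uminus)"
  then have [measurable]: "B \<in> sets borel" by simp
  have "emeasure (distr uniform_sym borel uminus) B = emeasure lborel ({-1..1} \<inter> uminus -` B) / 2"
    by (simp add: emeasure_distr emeasure_uniform_sym measurable_sets_borel[of uminus borel])
  also have "{-1..1} \<inter> uminus -` B = uminus -` ({-1..1} \<inter> B)" by auto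
  also have "emeasure lborel \<dots> = emeasure (distr lborel borel uminus) ({-1..1} \<inter> B)"
    by (subst emeasure_distr) auto
  finally show "emeasure (distr uniform_sym borel uminus) B = emeasure uniform_sym B"
    by (simp add: lborel_distr_uminus emeasure_uniform_sym)
qed simp

lemma real_distribution_atom_uniform: "real_distribution (atom_uniform w)"
  unfolding atom_uniform_def
  by (rule prob_space.real_distribution_distr[OF prob_space_uniform_sym]) simp

lemma atom_uniform_reflect: "distr (atom_uniform w) borel (\<lambda>x. x - 0) = distr (atom_uniform w) borel (\<lambda>x. 0 - x)"
proof -
  have "distr (atom_uniform w) borel (\<lambda>x. x - 0) = distr (distr uniform_sym borel uminus) borel (collapse w)"
    by (simp add: uniform_sym_reflect atom_uniform_def distr_distr comp_def)
  also have "\<dots> = distr uniform_sym borel (\<lambda>x. - collapse w x)"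
    by (subst distr_distr) (auto simp: comp_def collapse_def intro!: distr_cong)
  also have "\<dots> = distr (atom_uniform w) borel (\<lambda>x. 0 - x)"
    by (simp add: atom_uniform_def distr_distr comp_def)
  finally show ?thesis .
qed

lemma cdf_atom_uniform:
  assumes w: "0 < w" "w \<le> 1"
  shows "t < 0 \<Longrightarrow> cdf (atom_uniform w) t = max 0 ((t + w) / 2)"
    and "t \<ge> 0 \<Longrightarrow> cdf (atom_uniform w) t = 1 - max 0 ((w - t) / 2)"
proof -
  interpret U: prob_space uniform_sym by (rule prob_space_uniform_sym)
  have cdf: "cdf (atom_uniform w) t = measure uniform_sym {x. collapse w x \<le> t}"
    unfolding cdf_def2 atom_uniform_def by (subst measure_distr) (auto simp: vimage_def)
  {
    assume "t < 0"
    then have "{x. collapse w x \<le> t} = {-w..t}" using w by (auto simp: collapse_def)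
    moreover have "{-1..1} \<inter> {-w..t} = {-w..t}" using w \<open>t < 0\<close> by auto
    ultimately show "cdf (atom_uniform w) t = max 0 ((t + w) / 2)"
      unfolding cdf by (cases "- w \<le> t") (auto simp add: measure_uniform_sym max_def)
  }
  assume "t \<ge> 0"
  then have "{x. collapse w x \<le> t} = space uniform_sym - {t<..w}"
    using w by (auto simp: collapse_def)
  then have "cdf (atom_uniform w) t = 1 - measure uniform_sym {t<..w}"
    unfolding cdf using U.prob_compl[of "{t<..w}"] by simp
  moreover have "{-1..1} \<inter> {t<..w} = {t<..w}" using w \<open>t \<ge> 0\<close> by auto
  ultimately show "cdf (atom_uniform w) t = 1 - max 0 ((w - t) / 2)"
    by (cases "t \<le> w") (auto simp add: measure_uniform_sym max_def)
qed

lemma unimodal_atom_uniform: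
  assumes "0 < w" "w \<le> 1"
  shows "unimodal (atom_uniform w)"
  unfolding unimodal_def
proof (intro exI[of _ 0] conjI)
  have "convex_on {..<0} (\<lambda>t. max 0 ((t + w) / 2))"
  proof (rule convex_onI)
    fix t x y :: real assume t: "0 < t" "t < 1"
    have "((1 - t) * x + t * y + w) / 2 = (1 - t) * ((x + w) / 2) + t * ((y + w) / 2)"
      by (simp add: field_simps)
    also have "\<dots> \<le> (1 - t) * max 0 ((x + w) / 2) + t * max 0 ((y + w) / 2)"
      using t by (intro add_mono mult_left_mono) auto
    finally show "max 0 (((1 - t) *\<^sub>R x + t *\<^sub>R y + w) / 2)
        \<le> (1 - t) * max 0 ((x + w) / 2) + t * max 0 ((y + w) / 2)"
      using t by simp
  qed simp
  moreover have "u * x + v * y < 0" if "x < 0" "y < 0" "0 \<le> u" "0 \<le> v" "u + v = 1" for u v x y :: real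
    using convexD[OF convex_real_interval(4)[of 0], of x y u v] that by simp
  ultimately show "convex_on {..<0} (cdf (atom_uniform w))"
    by (simp add: convex_on_def cdf_atom_uniform assms)
  have "concave_on {0<..} (\<lambda>t. 1 - max 0 ((w - t) / 2))"
    unfolding concave_on_def
  proof (rule convex_onI)
    fix t x y :: real assume t: "0 < t" "t < 1"
    have "(w - ((1 - t) * x + t * y)) / 2 = (1 - t) * ((w - x) / 2) + t * ((w - y) / 2)"
      by (simp add: field_simps)
    also have "\<dots> \<le> (1 - t) * max 0 ((w - x) / 2) + t * max 0 ((w - y) / 2)"
      using t by (intro add_mono mult_left_mono) auto
    finally have "max 0 ((w - ((1 - t) *\<^sub>R x + t *\<^sub>R y)) / 2)
        \<le> (1 - t) * max 0 ((w - x) / 2) + t * max 0 ((w - y) / 2)"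
      using t by simp
    then show "- (1 - max 0 ((w - ((1 - t) *\<^sub>R x + t *\<^sub>R y)) / 2))
        \<le> (1 - t) * - (1 - max 0 ((w - x) / 2)) + t * - (1 - max 0 ((w - y) / 2))"
      by (simp add: algebra_simps)
  qed simp
  moreover have "u * x + v * y > 0" if "x > 0" "y > 0" "0 \<le> u" "0 \<le> v" "u + v = 1" for u v x y :: real
    using convexD[OF convex_real_interval(3)[of 0], of x y u v] that by simp
  ultimately show "concave_on {0<..} (cdf (atom_uniform w))"
    by (simp add: concave_on_iff cdf_atom_uniform assms less_imp_le)
qed

lemma atom_uniform_moment:
  assumes w: "0 < w" "w \<le> 1" and "n > 0"
  shows "(\<integral>x. x ^ n \<partial>atom_uniform w) = (w ^ Suc n - (- w) ^ Suc n) / (2 * Suc n)"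
proof -
  have "(\<integral>x. x ^ n \<partial>atom_uniform w) = (\<integral>x. collapse w x ^ n \<partial>uniform_sym)"
    unfolding atom_uniform_def by (subst integral_distr) auto
  also have "\<dots> = (\<integral>x. indicator {-1..1} x / 2 * collapse w x ^ n \<partial>lborel)"
    unfolding uniform_sym_def by (subst integral_real_density) auto
  also have "\<dots> = (\<integral>x. (x ^ n * indicator {- w..w} x) / 2 \<partial>lborel)"
    using w \<open>n > 0\<close>
    by (intro Bochner_Integration.integral_cong) (auto simp: collapse_def indicator_def)
  also have "\<dots> = (w ^ Suc n - (- w) ^ Suc n) / (2 * Suc n)"
    using w integral_power[of "-w" w n] by simp
  finally show ?thesis .
qed

lemma integrable_atom_uniform_power: 
  assumes "0 < w"
  shows "integrable (atom_uniform w) (\<lambda>x. x ^ n)"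
proof -
  interpret U: prob_space uniform_sym by (rule prob_space_uniform_sym)
  have "integrable uniform_sym (\<lambda>x. collapse w x ^ n)"
  proof (rule U.integrable_const_bound)
    show "AE x in uniform_sym. norm (collapse w x ^ n) \<le> w ^ n"
      using assms by (auto simp: collapse_def power_abs intro!: AE_I2 power_mono)
  qed measurable
  then show ?thesis unfolding atom_uniform_def by (subst integrable_distr_eq) auto
qed

lemma atom_uniform_variance_kurtosis:
  assumes w: "0 < w" "w \<le> 1"
  shows "dist_variance (atom_uniform w) = w ^ 3 / 3" and "kurtosis (atom_uniform w) = 9 / (5 * w)"
proof -
  interpret real_distribution "atom_uniform w" by (rule real_distribution_atom_uniform)
  have mean: "dist_mean (atom_uniform w) = 0"
    using symmetric_imp_mean_eq_center[OF atom_uniform_reflect] integrable_atom_uniform_power[of w 1] w by simp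
  show var: "dist_variance (atom_uniform w) = w ^ 3 / 3"
    using atom_uniform_moment[OF w, of 2] by (simp add: dist_variance_def mean)
  have "(\<integral>x. x ^ 4 \<partial>atom_uniform w) = w ^ 5 / 5"
    using atom_uniform_moment[OF w, of 4] by (simp add: numeral_eq_Suc)
  moreover have "sqrt (w ^ 3 / 3) ^ 4 = w ^ 6 / 9"
  proof -
    have "sqrt (w ^ 3 / 3) ^ 4 = (sqrt (w ^ 3 / 3) ^ 2) ^ 2" by (simp flip: power_mult)
    then show ?thesis using w by (simp add: power_divide flip: power_mult)
  qed
  ultimately show "kurtosis (atom_uniform w) = 9 / (5 * w)"
    using w by (simp add: kurtosis_def mean dist_sd_def var field_simps eval_nat_numeral)
qed

section \<open>The range of skewness and kurtosis\<close>

theorem theorem5p3: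
  shows "{(\<tau>, \<kappa>) | \<tau> \<kappa>. \<exists>M. real_distribution M \<and> integrable M (\<lambda>x. x ^ 4) \<and> dist_variance M > 0 \<and>
            symmetric_dist M \<and> unimodal M \<and> \<tau> = skewness M \<and> \<kappa> = kurtosis M}
       = {(0 :: real, y :: real) | y. y \<ge> 9 / 5}"
proof -
  have skew: "skewness M = 0"
    if "real_distribution M" "integrable M (\<lambda>x. x ^ 4)" and sd: "symmetric_dist M" for M
  proof -
    interpret real_distribution M by fact
    obtain c where sym: "distr M borel (\<lambda>x. x - c) = distr M borel (\<lambda>x. c - x)"
      using sd by (auto simp: symmetric_dist_def)
    have "dist_mean M = c"
      using symmetric_imp_mean_eq_center[OF sym] integrable_lower_power[OF that(2), of 1] by simp
    then show ?thesis
      using odd_central_moment_eq_0[OF sym, of 3] by (simp add: skewness_def)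
  qed
  have ge: "kurtosis M \<ge> 9 / 5"
    if "real_distribution M" "integrable M (\<lambda>x. x ^ 4)" "dist_variance M > 0"
       "symmetric_dist M" "unimodal M" for M
    using that real_distribution.symmetric_unimodal_kurtosis_ge
    unfolding symmetric_dist_def by blast
  have ex: "\<exists>M. real_distribution M \<and> integrable M (\<lambda>x. x ^ 4) \<and> dist_variance M > 0 \<and>
            symmetric_dist M \<and> unimodal M \<and> y = kurtosis M" if y: "y \<ge> 9 / 5" for y
  proof -
    define w where "w = 9 / (5 * y)"
    have w: "0 < w" "w \<le> 1" using y by (auto simp: w_def field_simps)
    have "y = kurtosis (atom_uniform w)"
      using atom_uniform_variance_kurtosis(2)[OF w] y by (simp add: w_def field_simps)
    moreover have "symmetric_dist (atom_uniform w)"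
      unfolding symmetric_dist_def using atom_uniform_reflect by blast
    moreover have "dist_variance (atom_uniform w) > 0"
      unfolding atom_uniform_variance_kurtosis(1)[OF w] using w by simp
    ultimately show ?thesis
      using real_distribution_atom_uniform integrable_atom_uniform_power[OF w(1)] unimodal_atom_uniform[OF w] by blast
  qed
  show ?thesis
  proof (intro equalityI subsetI; clarify)
    fix M :: "real measure"
    assume "real_distribution M" "integrable M (\<lambda>x. x ^ 4)" "dist_variance M > 0"
      "symmetric_dist M" "unimodal M"
    then show "\<exists>y. (skewness M, kurtosis M) = (0, y) \<and> y \<ge> 9 / 5"
      using skew[of M] ge[of M] by simp
  next
    fix y :: real assume "y \<ge> 9 / 5"
    then obtain M where "real_distribution M" "integrable M (\<lambda>x. x ^ 4)" "dist_variance M > 0"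
      "symmetric_dist M" "unimodal M" "y = kurtosis M" using ex by blast
    moreover have "0 = skewness M" using skew[of M] calculation by simp
    ultimately show "\<exists>\<tau> \<kappa>. (0, y) = (\<tau>, \<kappa>) \<and> (\<exists>M. real_distribution M \<and> integrable M (\<lambda>x. x ^ 4) \<and>
        dist_variance M > 0 \<and> symmetric_dist M \<and> unimodal M \<and> \<tau> = skewness M \<and> \<kappa> = kurtosis M)"
      by blast
  qed
qed

end
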